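(* Let $n\ge1$, $m>0$, $\varepsilon>0$, and let $\mathcal S=\{S_t\}_{t>0}$ be an approximation of the identity in $\mathbb R^n$ of order $m$ with constant $\varepsilon$, such that $\mathcal S'=\{t\partial_tS_t\}_{t>0}$ satisfies the bounds of order $m$ with constant $\varepsilon$. Then there exists a constant $C>0$ such that for every ball $B\subset\mathbb R^n$, every $x\in B$ and all admissible functions $f,g$, $$|f(x)g(x)-S_{r(B)^m}(f)(x)\,S_{r(B)^m}(g)(x)|\le C\sum_{l\ge0}2^{-l\varepsilon}\Big[\mathcal J_{2^{l+1}B}(|\nabla f|\chi_{2^{l+1}B},|g|\chi_{2^{l+1}B})(x)+\mathcal J_{2^{l+1}B}(|f|\chi_{2^{l+1}B},|\nabla g|\chi_{2^{l+1}B})(x)\Big].$$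
   Context: For a (Euclidean) ball $B$, $r(B)$ is its radius, $\lambda B$ the concentric ball of radius $\lambda r(B)$, $\chi_B$ its indicator function. For a ball $B\subset\mathbb R^n$, $$\mathcal J_B(f_1,f_2)(x)=\int_{B\times B}\frac{1}{(|x-a|+|x-b|)^{2n-1}}\log\Big(\frac{8\,r(B)}{|x-a|+|x-b|}\Big)f_1(a)f_2(b)\,da\,db,\qquad x\in B.$$ An approximation of the identity of order $m>0$ in $\mathbb R^n$ with constant $\varepsilon>0$ is a family $\{S_t\}_{t>0}$ of operators $S_tf(x)=\int_{\mathbb R^n}p_t(x,y)f(y)\,dy$ such that for each $t>0$: $\int_{\mathbb R^n}p_t(x,y)\,dy=1$ for all $x$, and $$|p_t(x,y)|\le t^{-n/m}\gamma\big(|x-y|/t^{1/m}\big),\qquad x,y\in\mathbb R^n,\qquad( * )$$ where $\gamma:[0,\infty)\to[0,\infty)$ is bounded, decreasing and $\lim_{r\to\infty}r^{2n+\varepsilon}\gamma(r)=0$. "$\mathcal S'=\{t\partial_tS_t\}_{t>0}$ satisfies the bounds of order $m$ with constant $\varepsilon$" means: $p_t(x,y)$ is differentiable in $t>0$ and the kernels $t\partial_tp_t(x,y)$ of $t\partial_tS_t$ satisfy $( * )$ with the same $m$ and some (possibly different) bounded decreasing $\gamma$ with $\lim_{r\to\infty}r^{2n+\varepsilon}\gamma(r)=0$. Admissible functions: $f,g\in C^1(\mathbb R^n)$ with $\int_{\mathbb R^n}(|f(y)|+|g(y)|)(1+|y|)^{-2n-\varepsilon}dy<\infty$, so that $S_tf,S_tg$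 are given by absolutely convergent integrals. *)

theory Defs
  imports "HOL-Analysis.Analysis"
begin

text \<open>
  \<open>'a :: euclidean_space\<close> plays the role of \<open>\<real>\<^sup>n\<close> with \<open>n = DIM('a)\<close>. Functions and kernels take
  values in \<open>'k :: {real_normed_field, euclidean_space}\<close>, which has the instances \<open>real\<close> and
  \<open>complex\<close>; thus both the real- and the complex-valued case are covered. Balls are open.
\<close>

text \<open>Euclidean length of the vector of partial derivatives.\<close>

definition grad_norm :: "('a::euclidean_space \<Rightarrow> 'k::real_normed_vector) \<Rightarrow> 'a \<Rightarrow> real" where
  "grad_norm f x = sqrt (\<Sum>i\<in>Basis. (norm (frechet_derivative f (at x) i))\<^sup>2)"

definition C1_function :: "('a::euclidean_space \<Rightarrow> 'k::real_normed_vector) \<Rightarrow> bool" where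
  "C1_function f \<longleftrightarrow>
     (\<forall>x. f differentiable (at x)) \<and>
     (\<forall>i\<in>Basis. continuous_on UNIV (\<lambda>x. frechet_derivative f (at x) i))"

definition admissible ::
  "real \<Rightarrow> ('a::euclidean_space \<Rightarrow> 'k::real_normed_vector) \<Rightarrow> ('a \<Rightarrow> 'k) \<Rightarrow> bool" where
  "admissible \<epsilon> f g \<longleftrightarrow>
     C1_function f \<and> C1_function g \<and>
     integrable lebesgue
       (\<lambda>y. (norm (f y) + norm (g y)) * (1 + norm y) powr (- 2 * real DIM('a) - \<epsilon>))"

text \<open>
  The operator \<open>\<J>\<^sub>B\<close> for \<open>B = ball c r\<close>. It is meant for nonnegative \<open>f1\<close>, \<open>f2\<close> and for \<open>x \<in> B\<close>; then
  \<open>\<bar>x - a\<bar> + \<bar>x - b\<bar> < 4 * r\<close> on \<open>B \<times> B\<close>, so the integrand is nonnegative and the integral is a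
  well-defined element of \<open>[0, \<infinity>]\<close>. (The integrand's value at the single point \<open>a = b = x\<close> is
  irrelevant.)
\<close>

definition J_op ::
  "'a::euclidean_space \<Rightarrow> real \<Rightarrow> ('a \<Rightarrow> real) \<Rightarrow> ('a \<Rightarrow> real) \<Rightarrow> 'a \<Rightarrow> ennreal" where
  "J_op c r f1 f2 x =
     (\<integral>\<^sup>+z\<in>ball c r \<times> ball c r.
        (case z of (a, b) \<Rightarrow>
           ennreal (1 / (norm (x - a) + norm (x - b)) ^ (2 * DIM('a) - 1)
                    * ln (8 * r / (norm (x - a) + norm (x - b))) * f1 a * f2 b))
      \<partial>lebesgue)"

text \<open>The bounds of order \<open>m\<close> with constant \<open>\<epsilon>\<close>; the profile \<open>\<gamma>\<close> does not depend on \<open>t\<close>.\<close>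

definition kernel_bounds ::
  "real \<Rightarrow> real \<Rightarrow> (real \<Rightarrow> 'a::euclidean_space \<Rightarrow> 'a \<Rightarrow> 'k::real_normed_vector) \<Rightarrow> bool" where
  "kernel_bounds m \<epsilon> q \<longleftrightarrow>
     (\<exists>\<gamma> :: real \<Rightarrow> real.
        (\<forall>s\<ge>0. 0 \<le> \<gamma> s) \<and> bounded (\<gamma> ` {0..}) \<and> antimono_on {0..} \<gamma> \<and>
        ((\<lambda>s. s powr (2 * real DIM('a) + \<epsilon>) * \<gamma> s) \<longlongrightarrow> 0) at_top \<and>
        (\<forall>t>0. \<forall>x y. norm (q t x y)
            \<le> t powr (- real DIM('a) / m) * \<gamma> (norm (x - y) / t powr (1 / m))))"

text \<open>
  A family of operators is represented by its kernels \<open>p t x y\<close>, of which only \<open>t > 0\<close> matters.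
\<close>

definition approx_identity ::
  "real \<Rightarrow> real \<Rightarrow>
   (real \<Rightarrow> 'a::euclidean_space \<Rightarrow> 'a \<Rightarrow> 'k::{real_normed_field, euclidean_space}) \<Rightarrow> bool" where
  "approx_identity m \<epsilon> p \<longleftrightarrow>
     (\<forall>t>0. \<forall>x. integrable lebesgue (p t x) \<and> (LINT y|lebesgue. p t x y) = 1) \<and>
     kernel_bounds m \<epsilon> p"

definition kernel_op ::
  "(real \<Rightarrow> 'a::euclidean_space \<Rightarrow> 'a \<Rightarrow> 'k::{real_normed_field, euclidean_space}) \<Rightarrow>
   real \<Rightarrow> ('a \<Rightarrow> 'k) \<Rightarrow> 'a \<Rightarrow> 'k" where
  "kernel_op p t f x = (LINT y|lebesgue. p t x y * f y)"

definition time_derivative_bounds ::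
  "real \<Rightarrow> real \<Rightarrow> (real \<Rightarrow> 'a::euclidean_space \<Rightarrow> 'a \<Rightarrow> 'k::real_normed_vector) \<Rightarrow> bool" where
  "time_derivative_bounds m \<epsilon> p \<longleftrightarrow>
     (\<forall>t>0. \<forall>x y. (\<lambda>s. p s x y) differentiable (at t)) \<and>
     kernel_bounds m \<epsilon> (\<lambda>t x y. t *\<^sub>R vector_derivative (\<lambda>s. p s x y) (at t))"

end

theory Submission
  imports Defs
begin

text \<open>
  Both factors are handled at once on the product space: as \<open>p t x\<close> has integral \<open>1\<close>, the left-hand
  side is the integral of \<open>p t x a * p t x b\<close> against \<open>f x * g x - f a * g b\<close>. Bounding this difference by the
  fundamental theorem of calculus along the segment from \<open>(x, x)\<close> to \<open>(a, b)\<close>, applying Tonelli's theorem and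
  rescaling around \<open>(x, x)\<close>, one arrives at a potential of the gradient of \<open>(a, b) \<mapsto> f a * g b\<close> with kernel
  \<open>\<rho> powr (1 - 2 * n) * (1 + \<rho> / r) powr - \<epsilon>\<close>, where \<open>\<rho> = \<bar>x - a\<bar> + \<bar>x - b\<bar>\<close>. The first dyadic ball
  containing both \<open>a\<close> and \<open>b\<close> turns the second factor into \<open>2 powr - (l * \<epsilon>)\<close>, and the logarithm in
  \<open>J_op\<close> is at least \<open>ln 2\<close>.
\<close>

section \<open>Averages along segments as potentials\<close>

text \<open>Here \<open>s\<close> will be a dilation factor and \<open>u\<close> a rescaled
  distance. For \<open>s > 0\<close> the integrand equals
  \<open>s powr (\<epsilon> - 1) * (s + u) powr - (d + \<epsilon>)\<close>; estimating
  \<open>s + u\<close> from below by \<open>u\<close> in \<open>d - 1\<close> of the factors leaves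
  a function with an explicit primitive.\<close>

lemma nn_integral_radial_powr_le:
  fixes u \<epsilon> :: real and d :: nat
  assumes u: "u > 0" and e: "\<epsilon> > 0" and d: "d \<ge> 1"
  shows "(\<integral>\<^sup>+s. ennreal (s powr - (real d + 1) * (1 + u / s) powr - (real d + \<epsilon>)) * indicator {0..1} s \<partial>lborel)
         \<le> ennreal ((1 + u) powr - \<epsilon> / (\<epsilon> * u ^ d))"
proof -
  \<comment> \<open>The quotient \<open>s / (s + u)\<close> has derivative
    \<open>u / (s + u)^2\<close>, which is why its \<open>\<epsilon>\<close>-th power, divided by
    \<open>\<epsilon> * u\<close>, is a primitive of \<open>h\<close>.\<close>
  define F where "F s = (s / (s + u)) powr \<epsilon> / (\<epsilon> * u)" for s :: real
  define h where "h s = s powr (\<epsilon> - 1) * (s + u) powr (- 1 - \<epsilon>)" for s :: real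
  have cont: "continuous_on {0..1} F"
    unfolding F_def using u e
    by (intro continuous_intros continuous_on_powr') auto
  have deriv: "(F has_vector_derivative h s) (at s)" if "s \<in> {0<..<1}" for s
  proof -
    from that have s: "s > 0" by simp
    have "((\<lambda>s. s / (s + u)) has_real_derivative u / (s + u)\<^sup>2) (at s)"
      using s u by (auto intro!: derivative_eq_intros simp: field_simps power2_eq_square)
    from DERIV_fun_powr[OF this, of \<epsilon>] s u
    have "(F has_real_derivative
        (\<epsilon> * (s / (s + u)) powr (\<epsilon> - 1) * (u / (s + u)\<^sup>2)) / (\<epsilon> * u)) (at s)"
      unfolding F_def by (intro DERIV_cdivide) simp
    also have "(\<epsilon> * (s / (s + u)) powr (\<epsilon> - 1) * (u / (s + u)\<^sup>2)) / (\<epsilon> * u)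
        = (s / (s + u)) powr (\<epsilon> - 1) * (s + u) powr (- 2)"
      using s u e by (simp add: powr_minus field_simps)
    also have "\<dots> = s powr (\<epsilon> - 1) * ((s + u) powr (- (\<epsilon> - 1)) * (s + u) powr (- 2))"
      using s u powr_minus_divide[of "s + u" "\<epsilon> - 1"] by (simp add: powr_divide)
    also have "\<dots> = h s"
      unfolding h_def powr_add[symmetric] by simp
    finally show ?thesis by (simp add: has_real_derivative_iff_has_vector_derivative)
  qed
  \<comment> \<open>For \<open>\<epsilon> < 1\<close> the function \<open>h\<close> is unbounded
    near \<open>0\<close>, so the derivative is used in the interior only, together with continuity
    of \<open>F\<close> up to the endpoints.\<close>
  have "(h has_integral (F 1 - F 0)) {0..1}"
    by (rule fundamental_theorem_of_calculus_interior[OF _ cont deriv]) auto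
  hence I: "((\<lambda>s. h s / u ^ (d - 1)) has_integral (F 1 - F 0) / u ^ (d - 1)) {0..1}"
    by (rule has_integral_divide)
  have "(\<integral>\<^sup>+s. ennreal (s powr - (real d + 1) * (1 + u / s) powr - (real d + \<epsilon>)) * indicator {0..1} s \<partial>lborel)
     \<le> (\<integral>\<^sup>+s. ennreal (h s / u ^ (d - 1)) * indicator {0..1} s \<partial>lborel)"
  proof (intro nn_integral_mono)
    fix s :: real
    show "ennreal (s powr - (real d + 1) * (1 + u / s) powr - (real d + \<epsilon>)) * indicator {0..1} s
          \<le> ennreal (h s / u ^ (d - 1)) * indicator {0..1} s"
    proof (cases "s \<in> {0<..1}")
      case True
      hence s: "s > 0" by simp
      have "s powr - (real d + 1) * (1 + u / s) powr - (real d + \<epsilon>)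
          = s powr - (real d + 1) * ((s + u) / s) powr - (real d + \<epsilon>)"
        using s by (simp add: add_divide_distrib)
      also have "\<dots> = (s powr - (real d + 1) * s powr (real d + \<epsilon>)) * (s + u) powr - (real d + \<epsilon>)"
        using s u by (simp add: powr_divide powr_minus_divide del: minus_add_distrib)
      also have "s powr - (real d + 1) * s powr (real d + \<epsilon>) = s powr (\<epsilon> - 1)"
        unfolding powr_add[symmetric] by simp
      also have "(s + u) powr - (real d + \<epsilon>) = (s + u) powr (- 1 - \<epsilon>) * (s + u) powr - real (d - 1)"
        unfolding powr_add[symmetric] using d by (intro arg_cong2[where f = "(powr)"]) (auto simp: of_nat_diff)
      also have "s powr (\<epsilon> - 1) * ((s + u) powr (- 1 - \<epsilon>) * (s + u) powr - real (d - 1))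
          = h s * (s + u) powr - real (d - 1)"
        by (simp add: h_def)
      also have "\<dots> = h s / (s + u) ^ (d - 1)"
        using s u by (simp add: powr_minus_divide powr_realpow)
      also have "\<dots> \<le> h s / u ^ (d - 1)"
        using s u by (intro divide_left_mono power_mono mult_pos_pos zero_less_power) (simp_all add: h_def)
      finally show ?thesis using True by (simp add: ennreal_leI)
    next
      case False
      \<comment> \<open>At \<open>s = 0\<close> the left-hand side vanishes because
        \<open>0 powr y = 0\<close>; the other \<open>s\<close> lie outside the indicator.\<close>
      thus ?thesis by (cases "s = 0") auto
    qed
  qed
  also have "\<dots> = ennreal ((F 1 - F 0) / u ^ (d - 1))"
    using u by (intro nn_integral_has_integral_lebesgue' I) (auto simp: h_def)
  also have "(F 1 - F 0) / u ^ (d - 1) = (1 + u) powr - \<epsilon> / (\<epsilon> * (u * u ^ (d - 1)))"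
    using u e by (simp add: F_def powr_divide powr_minus_divide)
  also have "u * u ^ (d - 1) = u ^ d"
    using d by (simp add: power_eq_if)
  finally show ?thesis .
qed

lemma nn_integral_lborel_affine:
  fixes f :: "'b::euclidean_space \<Rightarrow> ennreal"
  assumes [measurable]: "f \<in> borel_measurable borel" and c: "c \<noteq> 0"
  shows "(\<integral>\<^sup>+z. f z \<partial>lborel) = ennreal (\<bar>c\<bar> ^ DIM('b)) * (\<integral>\<^sup>+z. f (t + c *\<^sub>R z) \<partial>lborel)"
  by (subst lborel_affine[OF c, of t]) (simp add: nn_integral_density nn_integral_distr nn_integral_cmult)

text \<open>For fixed \<open>s\<close> substitute \<open>w = z0 + s *\<^sub>R (z - z0)\<close>;
  after Tonelli, the integral in \<open>s\<close> at fixed \<open>w\<close> is the one of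
  \<open>nn_integral_radial_powr_le\<close> with \<open>u = N (w - z0)\<close>. A homogeneous
  \<open>N\<close> stands in place of the norm because on the product space it will be a rescaled
  sum of two norms.\<close>

lemma nn_integral_segment_average_le:
  fixes N D :: "'b::euclidean_space \<Rightarrow> real" and z0 :: 'b
  assumes [measurable]: "N \<in> borel_measurable borel" "D \<in> borel_measurable borel"
    and N0: "\<And>z. N z \<ge> 0" and D0: "\<And>z. D z \<ge> 0"
    and hom: "\<And>s z. s > 0 \<Longrightarrow> N (s *\<^sub>R z) = s * N z"
    and e: "\<epsilon> > 0"
  shows "(\<integral>\<^sup>+z. ennreal ((1 + N (z - z0)) powr - (real DIM('b) + \<epsilon>) * N (z - z0)) *
            (\<integral>\<^sup>+s. ennreal (D (z0 + s *\<^sub>R (z - z0))) * indicator {0..1} s \<partial>lborel) \<partial>lborel)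
       \<le> ennreal (1 / \<epsilon>) * (\<integral>\<^sup>+w. ennreal ((1 + N (w - z0)) powr - \<epsilon> / N (w - z0) ^ (DIM('b) - 1) * D w) \<partial>lborel)"
proof -
  let ?d = "real DIM('b)"
  \<comment> \<open>The Jacobian contributes \<open>s powr - ?d\<close>, and homogeneity applied to
    the factor \<open>N (z - z0)\<close> contributes one more power of \<open>1 / s\<close>, whence
    the exponent \<open>?d + 1\<close>.\<close>
  define K where "K s w = s powr - (?d + 1) * (1 + N (w - z0) / s) powr - (?d + \<epsilon>)" for s :: real and w
  have [measurable]: "(\<lambda>(s, w). K s w) \<in> borel_measurable (borel \<Otimes>\<^sub>M borel)"
    unfolding K_def by measurable
  have scale: "(\<integral>\<^sup>+z. ennreal ((1 + N (z - z0)) powr - (?d + \<epsilon>) * N (z - z0) * D (z0 + s *\<^sub>R (z - z0))) \<partial>lborel)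
     = (\<integral>\<^sup>+w. ennreal (K s w * N (w - z0) * D w) \<partial>lborel)"
    (is "(\<integral>\<^sup>+z. ennreal (?G z) \<partial>lborel) = _") if s: "s > 0" for s
  proof -
    have "(\<integral>\<^sup>+z. ennreal (?G z) \<partial>lborel)
       = ennreal (\<bar>inverse s\<bar> ^ DIM('b)) * (\<integral>\<^sup>+w. ennreal (?G (z0 - inverse s *\<^sub>R z0 + inverse s *\<^sub>R w)) \<partial>lborel)"
    proof (rule nn_integral_lborel_affine)
      show "(\<lambda>z. ennreal (?G z)) \<in> borel_measurable borel"
        by measurable
    qed (use s in simp)
    also have "\<dots> = (\<integral>\<^sup>+w. ennreal (\<bar>inverse s\<bar> ^ DIM('b)) * ennreal (?G (z0 - inverse s *\<^sub>R z0 + inverse s *\<^sub>R w)) \<partial>lborel)"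
      by (rule nn_integral_cmult[symmetric]) measurable
    also have "\<dots> = (\<integral>\<^sup>+w. ennreal (K s w * N (w - z0) * D w) \<partial>lborel)"
    proof (rule nn_integral_cong)
      fix w
      have eq: "z0 - inverse s *\<^sub>R z0 + inverse s *\<^sub>R w - z0 = inverse s *\<^sub>R (w - z0)"
        by (simp add: algebra_simps)
      have N: "N (inverse s *\<^sub>R (w - z0)) = N (w - z0) / s"
        using s by (subst hom) (simp_all add: divide_inverse mult.commute)
      have "\<bar>inverse s\<bar> ^ DIM('b) * ?G (z0 - inverse s *\<^sub>R z0 + inverse s *\<^sub>R w) = K s w * N (w - z0) * D w"
      proof -
        have "s powr - (?d + 1) = \<bar>inverse s\<bar> ^ DIM('b) * inverse s"
          using s by (simp add: powr_minus powr_add powr_realpow power_inverse del: minus_add_distrib)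
        moreover have "z0 + s *\<^sub>R (inverse s *\<^sub>R (w - z0)) = w"
          using s by simp
        ultimately show ?thesis
          unfolding eq N K_def by (simp only: divide_inverse mult_ac)
      qed
      thus "ennreal (\<bar>inverse s\<bar> ^ DIM('b)) * ennreal (?G (z0 - inverse s *\<^sub>R z0 + inverse s *\<^sub>R w)) = ennreal (K s w * N (w - z0) * D w)"
        by (subst ennreal_mult'[symmetric]) simp_all
    qed
    finally show ?thesis .
  qed
  have "(\<integral>\<^sup>+z. ennreal ((1 + N (z - z0)) powr - (?d + \<epsilon>) * N (z - z0)) *
            (\<integral>\<^sup>+s. ennreal (D (z0 + s *\<^sub>R (z - z0))) * indicator {0..1} s \<partial>lborel) \<partial>lborel)
     = (\<integral>\<^sup>+z. (\<integral>\<^sup>+s. ennreal ((1 + N (z - z0)) powr - (?d + \<epsilon>) * N (z - z0) * D (z0 + s *\<^sub>R (z - z0)))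
           * indicator {0..1} s \<partial>lborel) \<partial>lborel)"
    by (intro nn_integral_cong, subst nn_integral_cmult[symmetric])
       (auto simp: ennreal_mult'' D0 N0 mult.assoc)
  also have "\<dots> = (\<integral>\<^sup>+s. (\<integral>\<^sup>+z. ennreal ((1 + N (z - z0)) powr - (?d + \<epsilon>) * N (z - z0) * D (z0 + s *\<^sub>R (z - z0)))
           * indicator {0..1} s \<partial>lborel) \<partial>lborel)"
    by (rule lborel_pair.Fubini') measurable
  \<comment> \<open>The substitution requires \<open>s > 0\<close>; the point \<open>s = 0\<close>
    is a null set and negative \<open>s\<close> are cut off by the indicator.\<close>
  also have "\<dots> = (\<integral>\<^sup>+s. (\<integral>\<^sup>+w. ennreal (K s w * N (w - z0) * D w) * indicator {0..1} s \<partial>lborel) \<partial>lborel)"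
  proof (intro nn_integral_cong_AE)
    show "AE s in lborel. (\<integral>\<^sup>+z. ennreal ((1 + N (z - z0)) powr - (?d + \<epsilon>) * N (z - z0) * D (z0 + s *\<^sub>R (z - z0)))
           * indicator {0..1} s \<partial>lborel) = (\<integral>\<^sup>+w. ennreal (K s w * N (w - z0) * D w) * indicator {0..1} s \<partial>lborel)"
      using AE_lborel_singleton[of "0::real"]
    proof eventually_elim
      case (elim s)
      show ?case
      proof (cases "s > 0")
        case True
        show ?thesis
          using arg_cong[OF scale[OF True], of "\<lambda>I. I * indicator {0..1} s"]
          by (simp add: nn_integral_multc)
      qed (use elim in auto)
    qed
  qed
  also have "\<dots> = (\<integral>\<^sup>+w. (\<integral>\<^sup>+s. ennreal (K s w * N (w - z0) * D w) * indicator {0..1} s \<partial>lborel) \<partial>lborel)"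
    by (rule lborel_pair.Fubini') measurable
  also have "\<dots> \<le> (\<integral>\<^sup>+w. ennreal (1 / \<epsilon>) * ennreal ((1 + N (w - z0)) powr - \<epsilon> / N (w - z0) ^ (DIM('b) - 1) * D w) \<partial>lborel)"
  proof (intro nn_integral_mono)
    fix w
    define u where "u = N (w - z0)"
    show "(\<integral>\<^sup>+s. ennreal (K s w * N (w - z0) * D w) * indicator {0..1} s \<partial>lborel)
       \<le> ennreal (1 / \<epsilon>) * ennreal ((1 + N (w - z0)) powr - \<epsilon> / N (w - z0) ^ (DIM('b) - 1) * D w)"
    \<comment> \<open>If \<open>u = 0\<close>, the separate factor \<open>N (w - z0)\<close> makes
      the left-hand side vanish. Otherwise that factor cancels one power of \<open>u\<close> in the
      radial bound and lowers the exponent \<open>DIM('b)\<close> by one.\<close>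
    proof (cases "u = 0")
      case False
      hence u: "u > 0" using N0 by (auto simp: u_def less_le)
      have "ennreal (K s w * N (w - z0) * D w) = ennreal (u * D w) * ennreal (K s w)" for s
        using u D0 by (subst ennreal_mult'[symmetric]) (simp_all add: u_def mult_ac)
      hence "(\<integral>\<^sup>+s. ennreal (K s w * N (w - z0) * D w) * indicator {0..1} s \<partial>lborel)
         = (\<integral>\<^sup>+s. ennreal (u * D w) * (ennreal (K s w) * indicator {0..1} s) \<partial>lborel)"
        by (simp only: mult.assoc)
      also have "\<dots> = ennreal (u * D w) * (\<integral>\<^sup>+s. ennreal (K s w) * indicator {0..1} s \<partial>lborel)"
        by (rule nn_integral_cmult) measurable
      also have "\<dots> \<le> ennreal (u * D w) * ennreal ((1 + u) powr - \<epsilon> / (\<epsilon> * u ^ DIM('b)))"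
        unfolding K_def u_def[symmetric] using u e
        by (intro mult_left_mono nn_integral_radial_powr_le) (auto simp: DIM_positive Suc_leI)
      also have "\<dots> = ennreal (u * D w * ((1 + u) powr - \<epsilon> / (\<epsilon> * u ^ DIM('b))))"
        using u e D0 by (intro ennreal_mult[symmetric]) auto
      also have "u ^ DIM('b) = u * u ^ (DIM('b) - 1)"
        by (simp add: power_eq_if)
      also have "u * D w * ((1 + u) powr - \<epsilon> / (\<epsilon> * (u * u ^ (DIM('b) - 1))))
          = (1 / \<epsilon>) * ((1 + u) powr - \<epsilon> / u ^ (DIM('b) - 1) * D w)"
        using u by (simp add: field_simps)
      also have "ennreal \<dots> = ennreal (1 / \<epsilon>) * ennreal ((1 + u) powr - \<epsilon> / u ^ (DIM('b) - 1) * D w)"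
        using u e D0 by (intro ennreal_mult) auto
      finally show ?thesis by (simp add: u_def)
    qed (simp add: u_def)
  qed
  also have "\<dots> = ennreal (1 / \<epsilon>) * (\<integral>\<^sup>+w. ennreal ((1 + N (w - z0)) powr - \<epsilon> / N (w - z0) ^ (DIM('b) - 1) * D w) \<partial>lborel)"
    by (intro nn_integral_cmult) measurable
  finally show ?thesis .
qed

section \<open>Gradients and increments along a segment\<close>

text \<open>Expand \<open>h\<close> in the orthonormal basis and apply Cauchy-Schwarz: the operator
  norm of the derivative is at most its Hilbert-Schmidt norm.\<close>

lemma norm_frechet_derivative_le_grad_norm:
  fixes f :: "'a::euclidean_space \<Rightarrow> 'k::real_normed_vector"
  assumes "f differentiable (at x)"
  shows "norm (frechet_derivative f (at x) h) \<le> grad_norm f x * norm h"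
proof -
  let ?f' = "frechet_derivative f (at x)"
  have lin: "linear ?f'"
    using assms by (rule linear_frechet_derivative)
  have "?f' h = ?f' (\<Sum>i\<in>Basis. (h \<bullet> i) *\<^sub>R i)"
    by (simp add: euclidean_representation)
  also have "\<dots> = (\<Sum>i\<in>Basis. (h \<bullet> i) *\<^sub>R ?f' i)"
    by (simp add: linear_sum[OF lin] linear_scale[OF lin])
  finally have "norm (?f' h) \<le> (\<Sum>i\<in>Basis. \<bar>norm (?f' i)\<bar> * \<bar>h \<bullet> i\<bar>)"
    by (auto intro!: order_trans[OF norm_sum] sum_mono simp: mult.commute)
  also have "\<dots> \<le> L2_set (\<lambda>i. norm (?f' i)) Basis * L2_set (\<lambda>i. h \<bullet> i) Basis"
    by (rule L2_set_mult_ineq)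
  also have "L2_set (\<lambda>i. h \<bullet> i) Basis = norm h"
    using euclidean_dist_l2[of h 0] by (simp add: dist_real_def L2_set_def)
  finally show ?thesis
    by (simp add: grad_norm_def L2_set_def)
qed

lemma grad_norm_nonneg: "grad_norm f x \<ge> 0"
  by (simp add: grad_norm_def sum_nonneg)

lemma continuous_on_grad_norm:
  assumes "C1_function f"
  shows "continuous_on UNIV (grad_norm f)"
  using assms unfolding grad_norm_def[abs_def] C1_function_def
  by (intro continuous_intros) auto

lemma continuous_on_C1_function:
  assumes "C1_function f"
  shows "continuous_on UNIV f"
  using assms unfolding C1_function_def
  by (auto intro!: differentiable_imp_continuous_on simp: differentiable_on_def)

text \<open>Dominates the gradient of \<open>(a, b) \<mapsto> f a * g b\<close>.\<close>

definition tensor_grad ::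
  "('a::euclidean_space \<Rightarrow> 'k::real_normed_field) \<Rightarrow> ('a \<Rightarrow> 'k) \<Rightarrow> 'a \<times> 'a \<Rightarrow> real" where
  "tensor_grad f g z = grad_norm f (fst z) * norm (g (snd z)) + norm (f (fst z)) * grad_norm g (snd z)"

lemma tensor_grad_nonneg: "tensor_grad f g z \<ge> 0"
  by (simp add: tensor_grad_def grad_norm_nonneg)

lemma continuous_on_tensor_grad:
  assumes "C1_function f" "C1_function g"
  shows "continuous_on UNIV (tensor_grad f g)"
proof -
  note cont = continuous_on_C1_function[OF assms(1)] continuous_on_C1_function[OF assms(2)]
    continuous_on_grad_norm[OF assms(1)] continuous_on_grad_norm[OF assms(2)]
  show ?thesis
    unfolding tensor_grad_def[abs_def]
    by (intro continuous_on_mult continuous_on_add continuous_on_norm cont[THEN continuous_on_compose2]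
          continuous_on_fst continuous_on_snd continuous_on_id) auto
qed

text \<open>The product rule and the fundamental theorem of calculus apply to
  \<open>f (A s) * g (B s)\<close>, where \<open>(A s, B s)\<close> runs along the segment. Both
  velocities \<open>a - x\<close> and \<open>b - x\<close> have norm at most the sum of the two
  distances, so this sum factors out and \<open>tensor_grad\<close> remains.\<close>

lemma norm_mult_diff_le_segment_integral:
  fixes f g :: "'a::euclidean_space \<Rightarrow> 'k::{real_normed_field, euclidean_space}"
  assumes f: "C1_function f" and g: "C1_function g"
  shows "ennreal (norm (f x * g x - f a * g b)) \<le> ennreal (norm (x - a) + norm (x - b)) *
     (\<integral>\<^sup>+s. ennreal (tensor_grad f g ((x, x) + s *\<^sub>R ((a, b) - (x, x)))) * indicator {0..1} s \<partial>lborel)"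
proof -
  define P where "P = norm (x - a) + norm (x - b)"
  define D where "D s = tensor_grad f g ((x, x) + s *\<^sub>R ((a, b) - (x, x)))" for s
  define A B where "A s = x + s *\<^sub>R (a - x)" and "B s = x + s *\<^sub>R (b - x)" for s
  define A' B' where "A' s = frechet_derivative f (at (A s)) (a - x)"
    and "B' s = frechet_derivative g (at (B s)) (b - x)" for s
  have D_eq: "D s = grad_norm f (A s) * norm (g (B s)) + norm (f (A s)) * grad_norm g (B s)" for s
    by (simp add: D_def A_def B_def tensor_grad_def)
  have deriv_line: "((\<lambda>s. h (x + s *\<^sub>R v)) has_vector_derivative frechet_derivative h (at (x + s *\<^sub>R v)) v) (at s within T)"
    if "C1_function h" for h :: "'a \<Rightarrow> 'k" and v s T
  proof -
    have "(h has_derivative frechet_derivative h (at (x + s *\<^sub>R v))) (at (x + s *\<^sub>R v))"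
      using that frechet_derivative_works by (auto simp: C1_function_def)
    moreover have "((\<lambda>s. x + s *\<^sub>R v) has_vector_derivative v) (at s within T)"
      by (auto intro!: derivative_eq_intros)
    ultimately show ?thesis
      using vector_derivative_diff_chain_within[of "\<lambda>s. x + s *\<^sub>R v" v s T h "frechet_derivative h (at (x + s *\<^sub>R v))"]
      by (simp add: o_def has_derivative_at_withinI)
  qed
  have "((\<lambda>s. f (A s) * g (B s)) has_vector_derivative f (A s) * B' s + A' s * g (B s)) (at s within {0..1})" for s
    unfolding A_def B_def A'_def B'_def
    by (intro has_vector_derivative_mult deriv_line f g)
  hence "((\<lambda>s. f (A s) * B' s + A' s * g (B s)) has_integral (f (A 1) * g (B 1) - f (A 0) * g (B 0))) {0..1}"
    by (intro fundamental_theorem_of_calculus) auto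
  hence int: "((\<lambda>s. f (A s) * B' s + A' s * g (B s)) has_integral (f a * g b - f x * g x)) {0..1}"
    by (simp add: A_def B_def)
  have "continuous_on {0..1} D"
    unfolding D_def
    by (rule continuous_on_compose2[OF continuous_on_tensor_grad[OF f g]]) (auto intro!: continuous_intros)
  hence "D integrable_on {0..1}"
    by (rule integrable_continuous_real)
  hence intD: "((\<lambda>s. P * D s) has_integral P * integral {0..1} D) {0..1}"
    by (intro has_integral_mult_right integrable_integral)
  have le: "norm (f (A s) * B' s + A' s * g (B s)) \<le> P * D s" for s
  proof -
    have "norm (B' s) \<le> grad_norm g (B s) * P"
      unfolding B'_def P_def using g
      by (intro order_trans[OF norm_frechet_derivative_le_grad_norm] mult_left_mono)
         (auto simp: C1_function_def grad_norm_nonneg norm_minus_commute)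
    moreover have "norm (A' s) \<le> grad_norm f (A s) * P"
      unfolding A'_def P_def using f
      by (intro order_trans[OF norm_frechet_derivative_le_grad_norm] mult_left_mono)
         (auto simp: C1_function_def grad_norm_nonneg norm_minus_commute)
    ultimately have "norm (f (A s)) * norm (B' s) + norm (A' s) * norm (g (B s))
        \<le> norm (f (A s)) * (grad_norm g (B s) * P) + grad_norm f (A s) * P * norm (g (B s))"
      by (intro add_mono mult_left_mono mult_right_mono) auto
    also have "\<dots> = P * D s"
      by (simp add: D_eq algebra_simps)
    finally show ?thesis
      using norm_triangle_ineq[of "f (A s) * B' s" "A' s * g (B s)"] by (simp add: norm_mult)
  qed
  have "norm (f x * g x - f a * g b) \<le> P * integral {0..1} D"
    using integral_norm_bound_integral[OF has_integral_integrable[OF int] has_integral_integrable[OF intD] le]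
    by (simp add: integral_unique[OF int] integral_unique[OF intD] norm_minus_commute)
  hence "ennreal (norm (f x * g x - f a * g b)) \<le> ennreal P * ennreal (integral {0..1} D)"
    by (subst ennreal_mult'[symmetric]) (auto simp: P_def intro: ennreal_leI)
  \<comment> \<open>Since \<open>D\<close> is nonnegative, its gauge integral is also its Lebesgue
    integral in \<open>ennreal\<close>, the form in which Tonelli's theorem will be applied.\<close>
  also have "ennreal (integral {0..1} D) = (\<integral>\<^sup>+s. ennreal (D s) * indicator {0..1} s \<partial>lborel)"
    using \<open>D integrable_on {0..1}\<close> unfolding D_def
    by (intro nn_integral_has_integral_lebesgue'[symmetric] integrable_integral tensor_grad_nonneg)
  finally show ?thesis
    by (simp add: P_def D_def)
qed

section \<open>Size of the kernel and of its tensor square\<close>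

text \<open>Boundedness of the profile for small arguments and its decay for large ones combine into
  a single power weight. With \<open>t = r powr m\<close> the scale \<open>t powr (1 / m)\<close> is
  \<open>r\<close> itself, so one \<open>K\<close> serves all \<open>r\<close>.\<close>

lemma kernel_bounds_powr:
  fixes q :: "real \<Rightarrow> 'a::euclidean_space \<Rightarrow> 'a \<Rightarrow> 'k::real_normed_vector"
  assumes "kernel_bounds m \<epsilon> q" and m: "m > 0" and e: "\<epsilon> > 0"
  obtains K where "K > 0"
    and "\<And>r x y. r > 0 \<Longrightarrow> norm (q (r powr m) x y)
          \<le> K / r ^ DIM('a) * (1 + norm (x - y) / r) powr - (2 * real DIM('a) + \<epsilon>)"
proof -
  define \<beta> where "\<beta> = 2 * real DIM('a) + \<epsilon>"
  have b: "\<beta> > 0" using e by (simp add: \<beta>_def add_nonneg_pos)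
  from assms(1) obtain \<gamma> :: "real \<Rightarrow> real" where
    g0: "\<And>s. s \<ge> 0 \<Longrightarrow> \<gamma> s \<ge> 0" and bd: "bounded (\<gamma> ` {0..})"
    and lim: "((\<lambda>s. s powr \<beta> * \<gamma> s) \<longlongrightarrow> 0) at_top"
    and q: "\<And>t x y. t > 0 \<Longrightarrow> norm (q t x y)
            \<le> t powr (- real DIM('a) / m) * \<gamma> (norm (x - y) / t powr (1 / m))"
    unfolding kernel_bounds_def \<beta>_def by blast
  from bd obtain M where "\<forall>v\<in>\<gamma> ` {0..}. norm v \<le> M"
    unfolding bounded_iff by blast
  hence M: "\<gamma> s \<le> M" if "s \<ge> 0" for s
    using that abs_le_D1[of "\<gamma> s" M] by simp
  from M[of 0] g0[of 0] have M0: "M \<ge> 0" by simp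
  have "\<forall>\<^sub>F s in at_top. s powr \<beta> * \<gamma> s < 1"
    using lim by (rule order_tendstoD) simp
  then obtain S0 where S0: "\<And>s. s \<ge> S0 \<Longrightarrow> s powr \<beta> * \<gamma> s < 1"
    by (auto simp: eventually_at_top_linorder)
  \<comment> \<open>For \<open>s \<ge> 1\<close> one has \<open>(1 + s) / 2 \<le> s\<close>, so
    \<open>s powr \<beta>\<close> may be replaced by \<open>(1 + s) powr \<beta>\<close> at the cost
    of \<open>2 powr \<beta>\<close>, the first summand of \<open>K\<close>. The second summand
    covers \<open>s < S\<close>.\<close>
  define S where "S = max 1 S0"
  define K where "K = 2 powr \<beta> + M * (1 + S) powr \<beta>"
  have K: "\<gamma> s \<le> K * (1 + s) powr - \<beta>" if s: "s \<ge> 0" for s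
  proof (cases "s \<ge> S")
    case True
    hence s1: "s \<ge> 1" "s powr \<beta> * \<gamma> s < 1"
      using S0[of s] by (auto simp: S_def)
    have "((1 + s) / 2) powr \<beta> * \<gamma> s \<le> s powr \<beta> * \<gamma> s"
      using s1 b g0[OF s] by (intro mult_right_mono powr_mono2) auto
    hence "2 powr \<beta> * (((1 + s) / 2) powr \<beta> * \<gamma> s) \<le> 2 powr \<beta> * 1"
      using s1 by (intro mult_left_mono) auto
    hence "(1 + s) powr \<beta> * \<gamma> s \<le> 2 powr \<beta>"
      using s1 by (simp add: powr_divide)
    also have "\<dots> \<le> K" using M0 by (simp add: K_def)
    finally show ?thesis
      using s by (simp add: powr_minus field_simps)
  next
    case False
    have "(1 + s) powr \<beta> * \<gamma> s \<le> (1 + S) powr \<beta> * M"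
      using False s b g0[OF s] M[OF s] by (intro mult_mono powr_mono2) auto
    also have "\<dots> \<le> K" by (simp add: K_def mult.commute)
    finally show ?thesis
      using s by (simp add: powr_minus field_simps)
  qed
  have "norm (q (r powr m) x y) \<le> K / r ^ DIM('a) * (1 + norm (x - y) / r) powr - \<beta>" if r: "r > 0" for r x y
  proof -
    have "norm (q (r powr m) x y) \<le> r powr - real DIM('a) * \<gamma> (norm (x - y) / r)"
      using q[of "r powr m" x y] r m by (simp add: powr_powr)
    also have "\<dots> \<le> r powr - real DIM('a) * (K * (1 + norm (x - y) / r) powr - \<beta>)"
      using r by (intro mult_left_mono K) auto
    finally show ?thesis using r by (simp add: powr_minus powr_realpow field_simps)
  qed
  moreover have "K > 0" using M0 by (auto simp: K_def intro: add_pos_nonneg)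
  ultimately show ?thesis using that by (simp add: \<beta>_def)
qed

text \<open>The weight exponent \<open>2 * DIM('a) + \<epsilon>\<close> is the dimension of the
  product space plus \<open>\<epsilon>\<close>, just what
  \<open>nn_integral_segment_average_le\<close> asks for when applied there with \<open>N\<close>
  the sum of the two norms divided by \<open>r\<close>.\<close>

lemma nn_integral_product_kernel_le:
  fixes f g :: "'a::euclidean_space \<Rightarrow> 'k::{real_normed_field, euclidean_space}"
  assumes f: "C1_function f" and g: "C1_function g" and r: "r > 0" and e: "\<epsilon> > 0" and K: "K > 0"
    and G: "\<And>y. G y = K / r ^ DIM('a) * (1 + norm (x - y) / r) powr - (2 * real DIM('a) + \<epsilon>)"
  shows "(\<integral>\<^sup>+a. ennreal (G a) * (\<integral>\<^sup>+b. ennreal (G b) * ennreal (norm (f x * g x - f a * g b)) \<partial>lborel) \<partial>lborel)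
    \<le> ennreal (K\<^sup>2 / \<epsilon>) *
      (\<integral>\<^sup>+(a, b). ennreal ((1 + (norm (x - a) + norm (x - b)) / r) powr - \<epsilon>
          / (norm (x - a) + norm (x - b)) ^ (2 * DIM('a) - 1) * tensor_grad f g (a, b)) \<partial>lborel)"
proof -
  let ?n = "DIM('a)"
  define \<beta> where "\<beta> = 2 * real ?n + \<epsilon>"
  define N :: "'a \<times> 'a \<Rightarrow> real" where "N z = (norm (fst z) + norm (snd z)) / r" for z
  define D where "D = tensor_grad f g"
  let ?z0 = "(x, x)"
  have contN: "continuous_on UNIV N"
    unfolding N_def[abs_def] using r by (intro continuous_intros) auto
  have [measurable]: "N \<in> borel_measurable borel" "D \<in> borel_measurable borel"
    using contN continuous_on_tensor_grad[OF f g]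
    by (auto simp: D_def intro: borel_measurable_continuous_onI)
  have contf: "continuous_on UNIV f" and contg: "continuous_on UNIV g"
    using f g by (auto intro: continuous_on_C1_function)
  have contG: "continuous_on UNIV G"
    unfolding G[abs_def] using r
    by (intro continuous_intros) (auto simp: add_nonneg_eq_0_iff)
  \<comment> \<open>Joint measurability, obtained here from continuity, turns the iterated integral
    into one over the product space.\<close>
  have "continuous_on UNIV (\<lambda>(a, b). G a * G b * norm (f x * g x - f a * g b))"
    unfolding case_prod_unfold
    by (intro continuous_intros continuous_on_compose2[OF contf] continuous_on_compose2[OF contg]
          continuous_on_compose2[OF contG]) auto
  hence "(\<lambda>(a, b). G a * G b * norm (f x * g x - f a * g b)) \<in> borel_measurable (borel \<Otimes>\<^sub>M borel)"
    by (simp add: borel_prod borel_measurable_continuous_onI)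
  hence prod_meas: "(\<lambda>(a, b). ennreal (G a * G b * norm (f x * g x - f a * g b))) \<in> borel_measurable (lborel \<Otimes>\<^sub>M lborel)"
    by (simp add: case_prod_unfold)
  have [measurable]: "f \<in> borel_measurable borel" "g \<in> borel_measurable borel" "G \<in> borel_measurable borel"
    using contf contg contG by (auto intro: borel_measurable_continuous_onI)
  have G0: "G y \<ge> 0" for y
    using K r by (simp add: G)
  have "(\<integral>\<^sup>+a. ennreal (G a) * (\<integral>\<^sup>+b. ennreal (G b) * ennreal (norm (f x * g x - f a * g b)) \<partial>lborel) \<partial>lborel)
      = (\<integral>\<^sup>+a. (\<integral>\<^sup>+b. ennreal (G a * G b * norm (f x * g x - f a * g b)) \<partial>lborel) \<partial>lborel)"
    by (intro nn_integral_cong, subst nn_integral_cmult[symmetric])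
       (simp_all add: ennreal_mult'' G0 mult.assoc)
  also have "\<dots> = (\<integral>\<^sup>+z. ennreal (G (fst z) * G (snd z) * norm (f x * g x - f (fst z) * g (snd z))) \<partial>lborel)"
    using lborel.nn_integral_fst[OF prod_meas] by (simp add: lborel_prod case_prod_unfold)
  also have "\<dots> \<le> (\<integral>\<^sup>+z. ennreal (K\<^sup>2 / r ^ (2 * ?n - 1)) * (ennreal ((1 + N (z - ?z0)) powr - (real DIM('a \<times> 'a) + \<epsilon>) * N (z - ?z0)) *
            (\<integral>\<^sup>+s. ennreal (D (?z0 + s *\<^sub>R (z - ?z0))) * indicator {0..1} s \<partial>lborel)) \<partial>lborel)"
  proof (intro nn_integral_mono, clarify)
    fix a b :: 'a
    let ?u = "norm (x - a) / r" and ?v = "norm (x - b) / r"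
    let ?I = "\<integral>\<^sup>+s. ennreal (D (?z0 + s *\<^sub>R ((a, b) - ?z0))) * indicator {0..1} s \<partial>lborel"
    have N: "N ((a, b) - ?z0) = ?u + ?v"
      using r by (simp add: N_def norm_minus_commute add_divide_distrib)
    have "G a * G b = (K / r ^ ?n)\<^sup>2 * ((1 + ?u) powr - \<beta> * (1 + ?v) powr - \<beta>)"
      by (simp only: G \<beta>_def power2_eq_square mult_ac)
    also have "\<dots> = K\<^sup>2 / r ^ (2 * ?n) * ((1 + ?u) * (1 + ?v)) powr - \<beta>"
      using r by (subst powr_mult) (simp_all add: power_divide power_mult[symmetric] mult.commute)
    \<comment> \<open>Dropping the product \<open>?u * ?v\<close> merges the two weights into one
      weight in the sum of the distances, without loss in the exponent.\<close>
    also have "\<dots> \<le> K\<^sup>2 / r ^ (2 * ?n) * (1 + (?u + ?v)) powr - \<beta>"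
    proof (intro mult_left_mono powr_mono2')
      have "0 \<le> ?u * ?v" using r by simp
      thus "1 + (?u + ?v) \<le> (1 + ?u) * (1 + ?v)" by (simp only: algebra_simps)
      show "0 < 1 + (?u + ?v)" using r by (intro add_pos_nonneg add_nonneg_nonneg) auto
    qed (use r e K in \<open>auto simp: \<beta>_def\<close>)
    finally have GG: "G a * G b \<le> K\<^sup>2 / r ^ (2 * ?n) * (1 + (?u + ?v)) powr - \<beta>" .
    have "ennreal (G a * G b * norm (f x * g x - f a * g b)) = ennreal (G a * G b) * ennreal (norm (f x * g x - f a * g b))"
      by (rule ennreal_mult'') simp
    also have "\<dots> \<le> ennreal (K\<^sup>2 / r ^ (2 * ?n) * (1 + (?u + ?v)) powr - \<beta>) * (ennreal (norm (x - a) + norm (x - b)) * ?I)"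
      unfolding D_def
      by (intro mult_mono ennreal_leI[OF GG] norm_mult_diff_le_segment_integral f g) auto
    also have "\<dots> = ennreal (K\<^sup>2 / r ^ (2 * ?n) * (1 + (?u + ?v)) powr - \<beta> * (norm (x - a) + norm (x - b))) * ?I"
      by (subst ennreal_mult''[of "norm (x - a) + norm (x - b)"])
         (simp_all only: add_nonneg_nonneg norm_ge_zero mult.assoc)
    \<comment> \<open>One of the \<open>2 * ?n\<close> powers of \<open>r\<close> is spent on
      rescaling the sum of the distances to \<open>?u + ?v\<close>.\<close>
    also have "K\<^sup>2 / r ^ (2 * ?n) * (1 + (?u + ?v)) powr - \<beta> * (norm (x - a) + norm (x - b))
        = K\<^sup>2 / r ^ (2 * ?n - 1) * ((1 + (?u + ?v)) powr - \<beta> * (?u + ?v))"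
    proof -
      have "r ^ (2 * ?n) = r * r ^ (2 * ?n - 1)"
        by (simp add: power_eq_if)
      thus ?thesis using r by (simp add: field_simps)
    qed
    also have "ennreal \<dots> = ennreal (K\<^sup>2 / r ^ (2 * ?n - 1)) * ennreal ((1 + (?u + ?v)) powr - \<beta> * (?u + ?v))"
      using r by (intro ennreal_mult) auto
    finally show "ennreal (G (fst (a, b)) * G (snd (a, b)) * norm (f x * g x - f (fst (a, b)) * g (snd (a, b))))
      \<le> ennreal (K\<^sup>2 / r ^ (2 * ?n - 1)) * (ennreal ((1 + N ((a, b) - ?z0)) powr - (real DIM('a \<times> 'a) + \<epsilon>) * N ((a, b) - ?z0)) * ?I)"
      unfolding N by (simp add: \<beta>_def mult.assoc)
  qed
  also have "\<dots> = ennreal (K\<^sup>2 / r ^ (2 * ?n - 1)) * (\<integral>\<^sup>+z. ennreal ((1 + N (z - ?z0)) powr - (real DIM('a \<times> 'a) + \<epsilon>) * N (z - ?z0)) *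
            (\<integral>\<^sup>+s. ennreal (D (?z0 + s *\<^sub>R (z - ?z0))) * indicator {0..1} s \<partial>lborel) \<partial>lborel)"
    by (intro nn_integral_cmult) measurable
  also have "\<dots> \<le> ennreal (K\<^sup>2 / r ^ (2 * ?n - 1)) * (ennreal (1 / \<epsilon>) *
       (\<integral>\<^sup>+w. ennreal ((1 + N (w - ?z0)) powr - \<epsilon> / N (w - ?z0) ^ (DIM('a \<times> 'a) - 1) * D w) \<partial>lborel))"
    using r e
    by (intro mult_left_mono nn_integral_segment_average_le)
       (measurable, auto simp: N_def D_def tensor_grad_nonneg distrib_left)
  also have "\<dots> = ennreal (K\<^sup>2 / r ^ (2 * ?n - 1) * (1 / \<epsilon>)) *
       (\<integral>\<^sup>+w. ennreal ((1 + N (w - ?z0)) powr - \<epsilon> / N (w - ?z0) ^ (DIM('a \<times> 'a) - 1) * D w) \<partial>lborel)"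
    using e by (subst ennreal_mult'') (simp_all only: mult.assoc zero_le_divide_1_iff less_imp_le)
  \<comment> \<open>The power of \<open>r\<close> is set apart because it cancels against the one
    contained in the denominator \<open>N (w - ?z0) ^ (2 * ?n - 1)\<close>; the constant that
    remains is independent of \<open>r\<close>.\<close>
  also have "K\<^sup>2 / r ^ (2 * ?n - 1) * (1 / \<epsilon>) = K\<^sup>2 / \<epsilon> * (1 / r ^ (2 * ?n - 1))"
    by simp
  also have "ennreal \<dots> = ennreal (K\<^sup>2 / \<epsilon>) * ennreal (1 / r ^ (2 * ?n - 1))"
    using r by (intro ennreal_mult'') simp
  also have "\<dots> * (\<integral>\<^sup>+w. ennreal ((1 + N (w - ?z0)) powr - \<epsilon> / N (w - ?z0) ^ (DIM('a \<times> 'a) - 1) * D w) \<partial>lborel)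
     = ennreal (K\<^sup>2 / \<epsilon>) * (\<integral>\<^sup>+w. ennreal (1 / r ^ (2 * ?n - 1)) * ennreal ((1 + N (w - ?z0)) powr - \<epsilon> / N (w - ?z0) ^ (DIM('a \<times> 'a) - 1) * D w) \<partial>lborel)"
    unfolding mult.assoc by (subst nn_integral_cmult) measurable
  also have "(\<integral>\<^sup>+w. ennreal (1 / r ^ (2 * ?n - 1)) * ennreal ((1 + N (w - ?z0)) powr - \<epsilon> / N (w - ?z0) ^ (DIM('a \<times> 'a) - 1) * D w) \<partial>lborel)
     = (\<integral>\<^sup>+(a, b). ennreal ((1 + (norm (x - a) + norm (x - b)) / r) powr - \<epsilon>
          / (norm (x - a) + norm (x - b)) ^ (2 * DIM('a) - 1) * tensor_grad f g (a, b)) \<partial>lborel)"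
  proof (intro nn_integral_cong, clarify)
    fix a b :: 'a
    have N: "N ((a, b) - ?z0) = (norm (x - a) + norm (x - b)) / r"
      by (simp add: N_def norm_minus_commute)
    show "ennreal (1 / r ^ (2 * ?n - 1)) * ennreal ((1 + N ((a, b) - ?z0)) powr - \<epsilon> / N ((a, b) - ?z0) ^ (DIM('a \<times> 'a) - 1) * D (a, b))
      = ennreal ((1 + (norm (x - a) + norm (x - b)) / r) powr - \<epsilon>
          / (norm (x - a) + norm (x - b)) ^ (2 * DIM('a) - 1) * tensor_grad f g (a, b))"
      unfolding N using r
      by (subst ennreal_mult'[symmetric])
         (auto simp: D_def tensor_grad_nonneg power_divide mult_2[symmetric])
  qed
  finally show ?thesis .
qed

text \<open>Since \<open>q\<close> has integral \<open>1\<close>, the difference equals the iterated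
  integral of \<open>q a * q b * (f x * g x - f a * g b)\<close>. Norms are taken inside one
  variable at a time, first in \<open>b\<close> and then in \<open>a\<close>.\<close>

lemma norm_mult_diff_kernel_le:
  fixes f g q :: "'a::euclidean_space \<Rightarrow> 'k::{real_normed_field, euclidean_space}"
  assumes fg: "admissible \<epsilon> f g" and r: "r > 0" and e: "\<epsilon> > 0" and K: "K > 0"
    and q: "integrable lebesgue q" "(LINT y|lebesgue. q y) = 1"
    and q_le: "\<And>y. norm (q y) \<le> G y"
    and G: "\<And>y. G y = K / r ^ DIM('a) * (1 + norm (x - y) / r) powr - (2 * real DIM('a) + \<epsilon>)"
  shows "ennreal (norm (f x * g x - (LINT y|lebesgue. q y * f y) * (LINT y|lebesgue. q y * g y)))
    \<le> (\<integral>\<^sup>+a. ennreal (G a) * (\<integral>\<^sup>+b. ennreal (G b) * ennreal (norm (f x * g x - f a * g b)) \<partial>lborel) \<partial>lborel)"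
proof -
  define \<beta> where "\<beta> = 2 * real DIM('a) + \<epsilon>"
  have b: "\<beta> > 0" using e by (simp add: \<beta>_def add_nonneg_pos)
  have C1: "C1_function f" "C1_function g"
    and int: "integrable lebesgue (\<lambda>y. (norm (f y) + norm (g y)) * (1 + norm y) powr - \<beta>)"
    using fg by (auto simp: admissible_def \<beta>_def)
  have G0: "G y \<ge> 0" for y
    using K r by (simp add: G)
  \<comment> \<open>Chosen so that \<open>1 + norm y \<le> C * (1 + norm (x - y) / r)\<close>: as
    \<open>C \<ge> 1 + norm x\<close> and \<open>C \<ge> r\<close>, the right-hand side is at least
    \<open>1 + norm x + norm (x - y)\<close>. This compares \<open>G\<close> with the weight in
    \<open>admissible\<close>.\<close>
  define C where "C = 1 + norm x + r"
  have C: "C > 0" using r by (auto simp: C_def intro: add_nonneg_pos)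
  have G_le: "G y \<le> K / r ^ DIM('a) * C powr \<beta> * (1 + norm y) powr - \<beta>" for y
  proof -
    have "1 + norm y \<le> 1 + norm x + norm (x - y)"
      using norm_triangle_ineq2[of y x] by (simp add: norm_minus_commute)
    also have "\<dots> \<le> C * (1 + norm (x - y) / r)"
      using r by (simp add: C_def field_simps)
    finally have le: "(C * (1 + norm (x - y) / r)) powr - \<beta> \<le> (1 + norm y) powr - \<beta>"
      using b by (intro powr_mono2') (auto intro: add_pos_nonneg)
    have "(1 + norm (x - y) / r) powr - \<beta> \<le> C powr \<beta> * (1 + norm y) powr - \<beta>"
    proof -
      from le have "C powr \<beta> * (C powr - \<beta> * (1 + norm (x - y) / r) powr - \<beta>) \<le> C powr \<beta> * (1 + norm y) powr - \<beta>"
        using C r by (intro mult_left_mono) (simp_all add: powr_mult)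
      thus ?thesis
        using C by (simp add: mult.assoc[symmetric] powr_add[symmetric])
    qed
    hence "K / r ^ DIM('a) * (1 + norm (x - y) / r) powr - \<beta> \<le> K / r ^ DIM('a) * (C powr \<beta> * (1 + norm y) powr - \<beta>)"
      using K r by (intro mult_left_mono) auto
    thus ?thesis by (simp add: G \<beta>_def mult.assoc)
  qed
  have int_q: "integrable lebesgue (\<lambda>y. q y * h y)"
    if "continuous_on UNIV h" and h: "\<And>y. norm (h y) \<le> norm (f y) + norm (g y)" for h :: "'a \<Rightarrow> 'k"
  proof (rule Bochner_Integration.integrable_bound)
    show "integrable lebesgue (\<lambda>y. K / r ^ DIM('a) * C powr \<beta> * ((norm (f y) + norm (g y)) * (1 + norm y) powr - \<beta>))"
      using int by (rule integrable_mult_right)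
    have "h \<in> borel_measurable lebesgue"
      using that(1) borel_measurable_continuous_onI by (intro measurable_completion) simp
    thus "(\<lambda>y. q y * h y) \<in> borel_measurable lebesgue"
      using q(1) by (intro borel_measurable_times) auto
    have "norm (q y * h y) \<le> norm (K / r ^ DIM('a) * C powr \<beta> * ((norm (f y) + norm (g y)) * (1 + norm y) powr - \<beta>))" for y
    proof -
      have "norm (q y * h y) \<le> (K / r ^ DIM('a) * C powr \<beta> * (1 + norm y) powr - \<beta>) * (norm (f y) + norm (g y))"
        unfolding norm_mult
        using K r by (intro mult_mono order_trans[OF q_le G_le] h) simp_all
      also have "\<dots> = K / r ^ DIM('a) * C powr \<beta> * ((norm (f y) + norm (g y)) * (1 + norm y) powr - \<beta>)"
        by (simp only: mult_ac)
      finally show ?thesis by (simp only: real_norm_def abs_ge_self[THEN order_trans[rotated]])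
    qed
    thus "AE y in lebesgue. norm (q y * h y) \<le> norm (K / r ^ DIM('a) * C powr \<beta> * ((norm (f y) + norm (g y)) * (1 + norm y) powr - \<beta>))"
      by simp
  qed
  have qf: "integrable lebesgue (\<lambda>y. q y * f y)" and qg: "integrable lebesgue (\<lambda>y. q y * g y)"
    by (intro int_q continuous_on_C1_function C1; simp)+
  let ?Sf = "LINT y|lebesgue. q y * f y" and ?Sg = "LINT y|lebesgue. q y * g y"
  have inner: "ennreal (norm (f x * g x - f a * ?Sg)) \<le> (\<integral>\<^sup>+b. ennreal (G b) * ennreal (norm (f x * g x - f a * g b)) \<partial>lborel)" for a
  proof -
    have "integrable lebesgue (\<lambda>b. q b * (f x * g x) - f a * (q b * g b))"
      using q qg by auto
    from integral_norm_bound_ennreal[OF this]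
    have "ennreal (norm (f x * g x - f a * ?Sg)) \<le> (\<integral>\<^sup>+b. norm (q b * (f x * g x) - f a * (q b * g b)) \<partial>lebesgue)"
      using q qg by simp
    \<comment> \<open>\<open>q\<close> is only known to be Lebesgue measurable; the nonnegative
      integral keeps its value when the completion is replaced by \<open>lborel\<close>.\<close>
    also have "\<dots> = (\<integral>\<^sup>+b. ennreal (norm (q b * (f x * g x - f a * g b))) \<partial>lborel)"
      unfolding nn_integral_completion by (simp add: algebra_simps)
    also have "\<dots> \<le> (\<integral>\<^sup>+b. ennreal (G b) * ennreal (norm (f x * g x - f a * g b)) \<partial>lborel)"
      by (intro nn_integral_mono)
         (auto simp: ennreal_mult'[symmetric] norm_mult G0 intro!: ennreal_leI mult_right_mono q_le)
    finally show ?thesis .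
  qed
  have "integrable lebesgue (\<lambda>a. q a * (f x * g x) - q a * f a * ?Sg)"
    using q qf by auto
  from integral_norm_bound_ennreal[OF this]
  have "ennreal (norm (f x * g x - ?Sf * ?Sg)) \<le> (\<integral>\<^sup>+a. norm (q a * (f x * g x) - q a * f a * ?Sg) \<partial>lebesgue)"
    using q qf by simp
  also have "\<dots> = (\<integral>\<^sup>+a. ennreal (norm (q a * (f x * g x - f a * ?Sg))) \<partial>lborel)"
    unfolding nn_integral_completion by (simp add: algebra_simps)
  also have "\<dots> \<le> (\<integral>\<^sup>+a. ennreal (G a) * (\<integral>\<^sup>+b. ennreal (G b) * ennreal (norm (f x * g x - f a * g b)) \<partial>lborel) \<partial>lborel)"
    by (intro nn_integral_mono)
       (auto simp: ennreal_mult' norm_mult G0 intro!: mult_mono ennreal_leI q_le inner)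
  finally show ?thesis .
qed

section \<open>Dyadic balls and comparison with \<open>J_op\<close>\<close>

text \<open>A pointwise comparison suffices: the one term of the series that belongs to the first
  ball containing both components of \<open>z\<close> already dominates the integrand up to
  \<open>1 / ln 2\<close>, and the other terms are nonnegative. Sum and integral are exchanged by
  monotone convergence.\<close>

lemma nn_integral_potential_le_J_op:
  fixes f g :: "'a::euclidean_space \<Rightarrow> 'k::real_normed_field"
  assumes f: "C1_function f" and g: "C1_function g" and r: "r > 0" and x: "x \<in> ball c r" and e: "\<epsilon> > 0"
  shows "(\<integral>\<^sup>+(a, b). ennreal ((1 + (norm (x - a) + norm (x - b)) / r) powr - \<epsilon>
          / (norm (x - a) + norm (x - b)) ^ (2 * DIM('a) - 1) * tensor_grad f g (a, b)) \<partial>lborel)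
    \<le> ennreal (1 / ln 2) * (\<Sum>l. ennreal (2 powr (- real l * \<epsilon>)) *
               (J_op c (2 ^ (l + 1) * r)
                  (\<lambda>a. grad_norm f a * indicator (ball c (2 ^ (l + 1) * r)) a)
                  (\<lambda>b. norm (g b) * indicator (ball c (2 ^ (l + 1) * r)) b) x
                + J_op c (2 ^ (l + 1) * r)
                  (\<lambda>a. norm (f a) * indicator (ball c (2 ^ (l + 1) * r)) a)
                  (\<lambda>b. grad_norm g b * indicator (ball c (2 ^ (l + 1) * r)) b) x))"
proof -
  let ?k = "2 * DIM('a) - 1"
  have k: "?k > 0" using DIM_positive[where 'a = 'a] by linarith
  define R where "R l = 2 ^ (l + 1) * r" for l :: nat
  define P where "P z = norm (x - fst z) + norm (x - snd z)" for z
  define L where "L l z = 1 / P z ^ ?k * ln (8 * R l / P z)" for l z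
  define I where "I l f1 f2 z = ennreal (L l z * (f1 (fst z) * indicator (ball c (R l)) (fst z))
      * (f2 (snd z) * indicator (ball c (R l)) (snd z))) * indicator (ball c (R l) \<times> ball c (R l)) z"
    for l :: nat and f1 f2 :: "'a \<Rightarrow> real" and z
  have J: "J_op c (R l) (\<lambda>a. f1 a * indicator (ball c (R l)) a) (\<lambda>b. f2 b * indicator (ball c (R l)) b) x
      = (\<integral>\<^sup>+z. I l f1 f2 z \<partial>lborel)" for l f1 f2
    unfolding J_op_def nn_integral_completion I_def L_def P_def by (simp add: case_prod_unfold)
  have [measurable]: "P \<in> borel_measurable (borel \<Otimes>\<^sub>M borel)"
    unfolding P_def[abs_def] by measurable
  have [measurable]: "grad_norm f \<in> borel_measurable borel" "grad_norm g \<in> borel_measurable borel"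
      "f \<in> borel_measurable borel" "g \<in> borel_measurable borel"
    by (intro borel_measurable_continuous_onI continuous_on_grad_norm f g
          continuous_on_C1_function[OF f] continuous_on_C1_function[OF g])+
  have [measurable]: "ball c (R l) \<in> sets borel" for l
    by simp
  have "I l f1 f2 \<in> borel_measurable (borel \<Otimes>\<^sub>M borel)"
    if [measurable]: "f1 \<in> borel_measurable borel" "f2 \<in> borel_measurable borel" for l f1 f2
    unfolding I_def[abs_def] L_def by measurable
  note [measurable] = this[unfolded borel_prod]
  define H where "H l z = ennreal (2 powr (- real l * \<epsilon>)) * (I l (grad_norm f) (\<lambda>b. norm (g b)) z + I l (\<lambda>a. norm (f a)) (grad_norm g) z)" for l z
  have [measurable]: "H l \<in> borel_measurable borel" for l
    unfolding H_def[abs_def] by measurable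
  have sum: "(\<Sum>l. ennreal (2 powr (- real l * \<epsilon>)) *
               (J_op c (R l) (\<lambda>a. grad_norm f a * indicator (ball c (R l)) a) (\<lambda>b. norm (g b) * indicator (ball c (R l)) b) x
                + J_op c (R l) (\<lambda>a. norm (f a) * indicator (ball c (R l)) a) (\<lambda>b. grad_norm g b * indicator (ball c (R l)) b) x))
      = (\<integral>\<^sup>+z. (\<Sum>l. H l z) \<partial>lborel)"
  proof -
    have "(\<integral>\<^sup>+z. H l z \<partial>lborel) = ennreal (2 powr (- real l * \<epsilon>)) *
        ((\<integral>\<^sup>+z. I l (grad_norm f) (\<lambda>b. norm (g b)) z \<partial>lborel) + (\<integral>\<^sup>+z. I l (\<lambda>a. norm (f a)) (grad_norm g) z \<partial>lborel))" for l
      unfolding H_def by (simp add: nn_integral_cmult nn_integral_add)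
    thus ?thesis
      unfolding J by (subst nn_integral_suminf) simp_all
  qed
  have pointwise: "ennreal ((1 + P z / r) powr - \<epsilon> / P z ^ ?k * tensor_grad f g z) \<le> ennreal (1 / ln 2) * (\<Sum>l. H l z)" for z
  proof (cases "P z = 0")
    case True
    \<comment> \<open>Division by \<open>0\<close> gives \<open>0\<close> and the exponent
      \<open>?k\<close> is positive, so the left-hand side is \<open>0\<close> at the single point
      \<open>(x, x)\<close>.\<close>
    show ?thesis unfolding True zero_power[OF k] by simp
  next
    case False
    hence P: "P z > 0" by (simp add: P_def less_le)
    define Q where "Q l \<longleftrightarrow> fst z \<in> ball c (R l) \<and> snd z \<in> ball c (R l)" for l
    obtain j :: nat where "(dist c (fst z) + dist c (snd z)) / r < 2 ^ j"
      using real_arch_pow[of 2] by auto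
    also have "\<dots> \<le> (2::real) ^ (j + 1)" by simp
    finally have "dist c (fst z) + dist c (snd z) < R j"
      using r by (simp add: R_def field_simps)
    hence "Q j"
      using zero_le_dist[of c "fst z"] zero_le_dist[of c "snd z"]
      unfolding Q_def mem_ball by linarith
    define l where "l = (LEAST l. Q l)"
    have "Q l" unfolding l_def using \<open>Q j\<close> by (rule LeastI)
    hence zl: "dist c (fst z) < R l" "dist c (snd z) < R l" by (auto simp: Q_def)
    \<comment> \<open>For \<open>l > 0\<close>, minimality puts one component outside the ball of
      the previous radius \<open>2 ^ l * r\<close>. As \<open>x\<close> is within \<open>r\<close>
      of \<open>c\<close>, that component is at distance at least \<open>2 ^ l * r - r\<close> from
      \<open>x\<close>. The shift in \<open>R l = 2 ^ (l + 1) * r\<close> thus yields the power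
      \<open>2 ^ l\<close> exactly.\<close>
    have large: "2 ^ l \<le> 1 + P z / r"
    proof (cases l)
      case 0
      thus ?thesis using P r by simp
    next
      case (Suc i)
      have "\<not> Q i" using Suc not_less_Least[of i Q] by (simp add: l_def)
      hence "R i \<le> dist c (fst z) \<or> R i \<le> dist c (snd z)"
        by (auto simp: Q_def)
      moreover have "dist c y \<le> r + norm (x - y)" for y
        using dist_triangle[of c y x] x by (simp add: dist_norm)
      ultimately have "R i \<le> r + P z"
        unfolding P_def using norm_ge_zero[of "x - fst z"] norm_ge_zero[of "x - snd z"] by smt
      thus ?thesis using r by (simp add: R_def Suc field_simps)
    qed
    have "(1 + P z / r) powr - \<epsilon> \<le> (2 ^ l) powr - \<epsilon>"
      using large e by (intro powr_mono2') auto
    also have "\<dots> = 2 powr (- real l * \<epsilon>)"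
      by (simp add: powr_realpow[symmetric] powr_powr)
    finally have decay: "(1 + P z / r) powr - \<epsilon> \<le> 2 powr (- real l * \<epsilon>)" .
    \<comment> \<open>Once \<open>r \<le> R l\<close>, the points \<open>x\<close>,
      \<open>fst z\<close> and \<open>snd z\<close> all lie in the ball of radius
      \<open>R l\<close>, so each of the two distances is below \<open>2 * R l\<close>; the constant
      \<open>8\<close> then makes the argument of the logarithm at least \<open>2\<close>.\<close>
    have "1 * r \<le> 2 ^ (l + 1) * r"
      using r by (intro mult_right_mono one_le_power) auto
    hence "r \<le> R l" by (simp add: R_def)
    hence "dist x c < R l" using x by (simp add: dist_commute)
    hence "P z < 4 * R l"
      using zl dist_triangle[of x "fst z" c] dist_triangle[of x "snd z" c]
      unfolding P_def dist_norm[symmetric] by linarith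
    hence "2 \<le> 8 * R l / P z"
      using P by (simp add: field_simps)
    hence ln2: "ln 2 \<le> ln (8 * R l / P z)"
      by simp
    hence "1 / P z ^ ?k * (ln 2 / ln 2) \<le> 1 / P z ^ ?k * (ln (8 * R l / P z) / ln 2)"
      using P by (intro mult_left_mono divide_right_mono) simp_all
    hence L: "1 / P z ^ ?k \<le> 1 / ln 2 * L l z"
      by (simp add: L_def mult.commute)
    \<comment> \<open>Nonnegativity of \<open>L l z\<close> lets \<open>ennreal\<close>, which sends
      negative reals to \<open>0\<close>, respect the products and the sum in
      \<open>H l z\<close>.\<close>
    have "0 \<le> ln (8 * R l / P z)"
      by (rule order_trans[OF _ ln2]) simp
    hence L0: "L l z \<ge> 0"
      unfolding L_def using P by (intro mult_nonneg_nonneg) simp_all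
    have "(1 + P z / r) powr - \<epsilon> / P z ^ ?k * tensor_grad f g z
       = (1 + P z / r) powr - \<epsilon> * (1 / P z ^ ?k) * tensor_grad f g z"
      by simp
    also have "\<dots> \<le> 2 powr (- real l * \<epsilon>) * (1 / ln 2 * L l z) * tensor_grad f g z"
      using P by (intro mult_right_mono mult_mono decay L tensor_grad_nonneg) auto
    also have "\<dots> = 1 / ln 2 * (2 powr (- real l * \<epsilon>) * (L l z * grad_norm f (fst z) * norm (g (snd z)) + L l z * norm (f (fst z)) * grad_norm g (snd z)))"
      by (simp add: tensor_grad_def algebra_simps)
    finally have "ennreal ((1 + P z / r) powr - \<epsilon> / P z ^ ?k * tensor_grad f g z) \<le> ennreal (1 / ln 2 * (2 powr (- real l * \<epsilon>) * (L l z * grad_norm f (fst z) * norm (g (snd z)) + L l z * norm (f (fst z)) * grad_norm g (snd z))))"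
      by (rule ennreal_leI)
    also have "\<dots> = ennreal (1 / ln 2) * H l z"
    proof -
      have "I l f1 f2 z = ennreal (L l z * f1 (fst z) * f2 (snd z))" for f1 f2
        using zl by (simp add: I_def mem_Times_iff)
      thus ?thesis
        using L0 unfolding H_def
        by (simp only: ennreal_mult'[symmetric] ennreal_plus[symmetric] grad_norm_nonneg mult_nonneg_nonneg
              norm_ge_zero powr_ge_zero zero_le_divide_1_iff ln_ge_zero one_le_numeral)
    qed
    also have "H l z \<le> (\<Sum>l. H l z)"
      using sum_le_suminf[of "\<lambda>l. H l z" "{l}"] by simp
    finally show ?thesis by (simp add: mult_left_mono)
  qed
  have "(\<integral>\<^sup>+(a, b). ennreal ((1 + (norm (x - a) + norm (x - b)) / r) powr - \<epsilon>
          / (norm (x - a) + norm (x - b)) ^ ?k * tensor_grad f g (a, b)) \<partial>lborel)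
      = (\<integral>\<^sup>+z. ennreal ((1 + P z / r) powr - \<epsilon> / P z ^ ?k * tensor_grad f g z) \<partial>lborel)"
    by (simp add: P_def case_prod_unfold)
  also have "\<dots> \<le> (\<integral>\<^sup>+z. ennreal (1 / ln 2) * (\<Sum>l. H l z) \<partial>lborel)"
    by (intro nn_integral_mono pointwise)
  also have "\<dots> = ennreal (1 / ln 2) * (\<integral>\<^sup>+z. (\<Sum>l. H l z) \<partial>lborel)"
    by (intro nn_integral_cmult) measurable
  finally show ?thesis
    unfolding sum[symmetric] R_def .
qed

section \<open>Uniformity of the constant over balls, points and functions\<close>

theorem theorem5:
  fixes p :: "real \<Rightarrow> 'a::euclidean_space \<Rightarrow> 'a \<Rightarrow> 'k::{real_normed_field, euclidean_space}"
    and m \<epsilon> :: real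
  assumes "m > 0" and "\<epsilon> > 0"
    and "approx_identity m \<epsilon> p"
    and "time_derivative_bounds m \<epsilon> p"
  shows "\<exists>C>0. \<forall>(c::'a) r x (f :: 'a \<Rightarrow> 'k) g.
           r > 0 \<longrightarrow> x \<in> ball c r \<longrightarrow> admissible \<epsilon> f g \<longrightarrow>
           ennreal (norm (f x * g x - kernel_op p (r powr m) f x * kernel_op p (r powr m) g x))
           \<le> ennreal C * (\<Sum>l. ennreal (2 powr (- real l * \<epsilon>)) *
               (J_op c (2 ^ (l + 1) * r)
                  (\<lambda>a. grad_norm f a * indicator (ball c (2 ^ (l + 1) * r)) a)
                  (\<lambda>b. norm (g b) * indicator (ball c (2 ^ (l + 1) * r)) b) x
                + J_op c (2 ^ (l + 1) * r)
                  (\<lambda>a. norm (f a) * indicator (ball c (2 ^ (l + 1) * r)) a)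
                  (\<lambda>b. grad_norm g b * indicator (ball c (2 ^ (l + 1) * r)) b) x))"
proof -
  have p: "integrable lebesgue (p t x)" "(LINT y|lebesgue. p t x y) = 1" if "t > 0" for t x
    using assms(3) that by (auto simp: approx_identity_def)
  from assms(3) have "kernel_bounds m \<epsilon> p"
    by (simp add: approx_identity_def)
  then obtain K where K: "K > 0"
    and p_le: "\<And>r x y. r > 0 \<Longrightarrow> norm (p (r powr m) x y)
          \<le> K / r ^ DIM('a) * (1 + norm (x - y) / r) powr - (2 * real DIM('a) + \<epsilon>)"
    using kernel_bounds_powr assms(1,2) by blast
  show ?thesis
  \<comment> \<open>The kernel bound enters once for each factor, which gives the square of
    \<open>K\<close>; \<open>1 / \<epsilon>\<close> comes from the radial integral and
    \<open>1 / ln 2\<close> from the logarithm. \<open>K\<close> was fixed before the ball, the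
    point and the functions.\<close>
  proof (intro exI[of _ "K\<^sup>2 / \<epsilon> * (1 / ln 2)"] conjI allI impI)
    show "0 < K\<^sup>2 / \<epsilon> * (1 / ln 2)"
      using K assms(2) by simp
    fix c x :: 'a and r :: real and f g :: "'a \<Rightarrow> 'k"
    assume r: "r > 0" and x: "x \<in> ball c r" and fg: "admissible \<epsilon> f g"
    hence C1: "C1_function f" "C1_function g" by (auto simp: admissible_def)
    have t: "r powr m > 0" using r by simp
    show "ennreal (norm (f x * g x - kernel_op p (r powr m) f x * kernel_op p (r powr m) g x))
           \<le> ennreal (K\<^sup>2 / \<epsilon> * (1 / ln 2)) * (\<Sum>l. ennreal (2 powr (- real l * \<epsilon>)) *
               (J_op c (2 ^ (l + 1) * r)
                  (\<lambda>a. grad_norm f a * indicator (ball c (2 ^ (l + 1) * r)) a)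
                  (\<lambda>b. norm (g b) * indicator (ball c (2 ^ (l + 1) * r)) b) x
                + J_op c (2 ^ (l + 1) * r)
                  (\<lambda>a. norm (f a) * indicator (ball c (2 ^ (l + 1) * r)) a)
                  (\<lambda>b. grad_norm g b * indicator (ball c (2 ^ (l + 1) * r)) b) x))"
      (is "_ \<le> _ * ?J")
    proof -
      have "ennreal (norm (f x * g x - kernel_op p (r powr m) f x * kernel_op p (r powr m) g x))
         \<le> ennreal (K\<^sup>2 / \<epsilon>) * (\<integral>\<^sup>+(a, b). ennreal ((1 + (norm (x - a) + norm (x - b)) / r) powr - \<epsilon>
          / (norm (x - a) + norm (x - b)) ^ (2 * DIM('a) - 1) * tensor_grad f g (a, b)) \<partial>lborel)"
        unfolding kernel_op_def
        by (rule order_trans[OF norm_mult_diff_kernel_le nn_integral_product_kernel_le])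
           (fact fg r assms(2) K p(1)[OF t] p(2)[OF t] p_le[OF r] refl C1)+
      also have "\<dots> \<le> ennreal (K\<^sup>2 / \<epsilon>) * (ennreal (1 / ln 2) * ?J)"
        by (intro mult_left_mono nn_integral_potential_le_J_op C1 r x assms(2)) simp
      also have "\<dots> = ennreal (K\<^sup>2 / \<epsilon> * (1 / ln 2)) * ?J"
        by (subst ennreal_mult'') (simp_all add: mult.assoc)
      finally show ?thesis .
    qed
  qed
qed

end
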